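(* If $p(n)=o\!\left(n^{-\frac{n}{2(n-2)}}\right)$ and $\Gamma\in G(n,p(n))$, then asymptotically almost surely $W_\Gamma$ is not strongly algebraically thick of order $0$ (not wide), and hence has at least quadratic divergence.
   Context: $G(n,p)$: random graphs on $n$ vertices, each edge present independently with probability $p$; a.a.s. means with probability tending to $1$ as $n\to\infty$. $W_\Gamma$ is the right-angled Coxeter group of $\Gamma$. A group is wide (strongly algebraically thick of order $0$) if no asymptotic cone has a cut point. Divergence is the Gersten divergence function of a Cayley graph, up to the standard equivalence $\asymp$; "at least quadratic" means $s^2\preccurlyeq$ divergence (and includes infinite divergence). *)

theory Defs
  imports Complex_Main "HOL-Library.Landau_Symbols" "HOL-Library.Extended_Real"
begin

text \<open>Vertices are 0,...,n-1; a graph is its set of edges, each edge a 2-element set.\<close>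
definition all_edges :: "nat \<Rightarrow> nat set set" where
  "all_edges n = {{i, j} | i j. i < j \<and> j < n}"

definition gnp_prob :: "nat \<Rightarrow> real \<Rightarrow> (nat set set \<Rightarrow> bool) \<Rightarrow> real" where
  "gnp_prob n p Q = (\<Sum>E \<in> Pow (all_edges n).
      (if Q E then p ^ card E * (1 - p) ^ (card (all_edges n) - card E) else 0))"

text \<open>W_Gamma is the monoid on the vertices modulo the congruence generated by
  s s = 1 and s t = t s for adjacent s, t (this is the group presentation,
  since every generator is an involution).\<close>
inductive racg_step :: "nat set set \<Rightarrow> nat list \<Rightarrow> nat list \<Rightarrow> bool" for E where
  del: "racg_step E (x @ [s, s] @ y) (x @ y)"
| comm: "{s, t} \<in> E \<Longrightarrow> racg_step E (x @ [s, t] @ y) (x @ [t, s] @ y)"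

definition racg_eq :: "nat set set \<Rightarrow> nat list \<Rightarrow> nat list \<Rightarrow> bool" where
  "racg_eq E = (\<lambda>u v. racg_step E u v \<or> racg_step E v u)\<^sup>*\<^sup>*"

definition racg_words :: "nat \<Rightarrow> nat list set" where
  "racg_words n = {w. set w \<subseteq> {..<n}}"

text \<open>Word metric (distance in the Cayley graph w.r.t. the standard generators);
  rev u represents the inverse of u.\<close>
definition racg_dist :: "nat \<Rightarrow> nat set set \<Rightarrow> nat list \<Rightarrow> nat list \<Rightarrow> real" where
  "racg_dist n E u v =
     real (LEAST k. \<exists>w \<in> racg_words n. length w = k \<and> racg_eq E (rev u @ v) w)"

definition nonprincipal_ultrafilter :: "nat filter \<Rightarrow> bool" where
  "nonprincipal_ultrafilter \<omega> \<longleftrightarrow> \<omega> \<noteq> bot \<and> \<omega> \<le> sequentially \<and>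
     (\<forall>P. eventually P \<omega> \<or> eventually (\<lambda>n. \<not> P n) \<omega>)"

definition cone_pts :: "'a set \<Rightarrow> ('a \<Rightarrow> 'a \<Rightarrow> real) \<Rightarrow> nat filter \<Rightarrow> (nat \<Rightarrow> real)
    \<Rightarrow> (nat \<Rightarrow> 'a) \<Rightarrow> (nat \<Rightarrow> 'a) set" where
  "cone_pts X d \<omega> s b = {x. (\<forall>n. x n \<in> X) \<and> (\<exists>C. eventually (\<lambda>n. d (b n) (x n) / s n \<le> C) \<omega>)}"

definition cone_dist :: "('a \<Rightarrow> 'a \<Rightarrow> real) \<Rightarrow> nat filter \<Rightarrow> (nat \<Rightarrow> real)
    \<Rightarrow> (nat \<Rightarrow> 'a) \<Rightarrow> (nat \<Rightarrow> 'a) \<Rightarrow> real" where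
  "cone_dist d \<omega> s x y = Lim \<omega> (\<lambda>n. d (x n) (y n) / s n)"

definition pm_open :: "'b set \<Rightarrow> ('b \<Rightarrow> 'b \<Rightarrow> real) \<Rightarrow> 'b set \<Rightarrow> bool" where
  "pm_open Y D U \<longleftrightarrow> U \<subseteq> Y \<and> (\<forall>x\<in>U. \<exists>e>0. \<forall>y\<in>Y. D x y < e \<longrightarrow> y \<in> U)"

definition pm_disconnected :: "'b set \<Rightarrow> ('b \<Rightarrow> 'b \<Rightarrow> real) \<Rightarrow> bool" where
  "pm_disconnected Y D \<longleftrightarrow> (\<exists>U V. pm_open Y D U \<and> pm_open Y D V \<and> U \<noteq> {} \<and> V \<noteq> {}
      \<and> U \<inter> V = {} \<and> Y \<subseteq> U \<union> V)"

definition has_cut_point :: "'a set \<Rightarrow> ('a \<Rightarrow> 'a \<Rightarrow> real) \<Rightarrow> nat filter \<Rightarrow> (nat \<Rightarrow> real)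
    \<Rightarrow> (nat \<Rightarrow> 'a) \<Rightarrow> bool" where
  "has_cut_point X d \<omega> s b \<longleftrightarrow> (\<exists>c \<in> cone_pts X d \<omega> s b.
      pm_disconnected {x \<in> cone_pts X d \<omega> s b. cone_dist d \<omega> s x c > 0} (cone_dist d \<omega> s))"

definition wide :: "'a set \<Rightarrow> ('a \<Rightarrow> 'a \<Rightarrow> real) \<Rightarrow> bool" where
  "wide X d \<longleftrightarrow> \<not> (\<exists>\<omega> s b. nonprincipal_ultrafilter \<omega> \<and> (\<forall>n. s n > 0) \<and>
      filterlim s at_top \<omega> \<and> (\<forall>n. b n \<in> X) \<and> has_cut_point X d \<omega> s b)"

section \<open>Divergence (Gersten / Drutu--Mozes--Sapir)\<close>

text \<open>Edge paths in the Cayley graph: sequences of vertices, consecutive ones adjacent.\<close>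
definition is_path :: "'a set \<Rightarrow> ('a \<Rightarrow> 'a \<Rightarrow> real) \<Rightarrow> 'a \<Rightarrow> 'a \<Rightarrow> 'a list \<Rightarrow> bool" where
  "is_path X d x y p \<longleftrightarrow> p \<noteq> [] \<and> hd p = x \<and> last p = y \<and> set p \<subseteq> X \<and>
     (\<forall>i < length p - 1. d (p ! i) (p ! Suc i) \<le> 1)"

definition div_pt :: "'a set \<Rightarrow> ('a \<Rightarrow> 'a \<Rightarrow> real) \<Rightarrow> real \<Rightarrow> real \<Rightarrow> 'a \<Rightarrow> 'a \<Rightarrow> 'a \<Rightarrow> ereal" where
  "div_pt X d \<delta> \<gamma> x y c = Inf {ereal (real (length p - 1)) | p. is_path X d x y p \<and>
      (\<forall>z \<in> set p. d c z \<ge> \<delta> * min (d c x) (d c y) - \<gamma>)}"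

definition Div :: "'a set \<Rightarrow> ('a \<Rightarrow> 'a \<Rightarrow> real) \<Rightarrow> real \<Rightarrow> real \<Rightarrow> real \<Rightarrow> ereal" where
  "Div X d \<delta> \<gamma> t = Sup {div_pt X d \<delta> \<gamma> x y c | x y c. x \<in> X \<and> y \<in> X \<and> c \<in> X \<and> d x y \<le> t}"

text \<open>t^2 \<preceq> Div, with the standard equivalence f \<preceq> g iff f(t) \<le> C g(Ct+C) + Ct + C.\<close>
definition at_least_quadratic_div :: "'a set \<Rightarrow> ('a \<Rightarrow> 'a \<Rightarrow> real) \<Rightarrow> bool" where
  "at_least_quadratic_div X d \<longleftrightarrow> (\<exists>C>0. \<forall>t\<ge>0.
      ereal (t ^ 2) \<le> ereal C * Div X d (1/2) 2 (C * t + C) + ereal (C * t + C))"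

end

theory Submission
  imports Defs "HOL-Analysis.Elementary_Topology" "HOL-Real_Asymp.Real_Asymp"
begin

text \<open>
  Since \<open>p \<rightarrow> 0\<close>, a union bound shows that a.a.s. any two vertices have a common
  non-neighbour, so that there is an infinite walk \<open>v\<close> in the complement of \<open>\<Gamma>\<close> which visits every
  vertex within each window of \<open>2 * n\<close> steps. Consecutive letters of \<open>v\<close> do not commute, so its
  prefixes form a geodesic ray, and \<open>d x (v\<^sub>0 \<dots> v\<^sub>i\<^sub>-\<^sub>1) = m + \<bar>i - k x\<bar>\<close> for a nearest-point projection \<open>k\<close>.
  A letter cancelling across a segment of \<open>v\<close> has to commute with all letters of the segment; no
  letter commutes with all vertices (itself included), so if \<open>k x\<close> and \<open>k y\<close> are at least \<open>2 * n\<close>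
  apart, then the geodesics from \<open>x\<close> to the ray, along the ray, and from the ray to \<open>y\<close> concatenate
  to a geodesic. Hence the ray is strongly contracting: in an asymptotic cone based far out on the
  ray the base point separates the points projecting to its right from the others, and a path
  avoiding a ball of radius \<open>R\<close> around a ray point pays a linear cost for each of
  linearly many segments of the ray.
\<close>

section \<open>Contracting rays\<close>

text \<open>Zorn's lemma on the proper filters below \<open>sequentially\<close>, each represented
  by its set of eventual properties: inclusion of these sets is refinement, and a maximal one
  decides every property.\<close>

lemma ex_nonprincipal_ultrafilter: "\<exists>\<omega>. nonprincipal_ultrafilter \<omega>"
proof -
  define ev where "ev = (\<lambda>F :: nat filter. {P. eventually P F})"
  have ev_mono: "ev F \<subseteq> ev G \<longleftrightarrow> G \<le> F" for F G
    by (auto simp: ev_def le_filter_def)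
  define \<F> where "\<F> = {F :: nat filter. F \<noteq> bot \<and> F \<le> sequentially}"
  have "\<exists>M\<in>ev ` \<F>. \<forall>X\<in>ev ` \<F>. M \<subseteq> X \<longrightarrow> X = M"
  proof (rule subset_Zorn)
    fix C assume C: "subset.chain (ev ` \<F>) C"
    show "\<exists>U\<in>ev ` \<F>. \<forall>X\<in>C. X \<subseteq> U"
    proof (cases "C = {}")
      case True
      moreover have "sequentially \<in> \<F>" by (simp add: \<F>_def)
      ultimately show ?thesis by blast
    next
      case False
      define B where "B = {F \<in> \<F>. ev F \<in> C}"
      have C_img: "C = ev ` B" using C by (auto simp: B_def subset.chain_def)
      then have "B \<noteq> {}" using False by blast
      \<comment> \<open>In a chain the finer of two members lies below both. So a property holds
        eventually in \<open>Inf B\<close> iff it does in some member, and \<open>Inf B\<close>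
        stays proper.\<close>
      have base: "\<exists>x\<in>B. x \<le> inf F G" if "F \<in> B" "G \<in> B" for F G
      proof -
        have "ev F \<subseteq> ev G \<or> ev G \<subseteq> ev F"
          using C that unfolding B_def subset_chain_def by blast
        then have "G \<le> F \<or> F \<le> G" by (simp only: ev_mono)
        then show ?thesis using that le_inf_iff[of _ F G] order_refl by metis
      qed
      have "eventually P (Inf B) \<longleftrightarrow> (\<exists>b\<in>B. eventually P b)" for P
        by (rule eventually_Inf_base[OF \<open>B \<noteq> {}\<close> base])
      then have "Inf B \<noteq> bot"
        by (auto simp: trivial_limit_def B_def \<F>_def)
      moreover have "Inf B \<le> sequentially"
        using \<open>B \<noteq> {}\<close> Inf_less_eq[of B sequentially] by (simp add: B_def \<F>_def)
      ultimately have "Inf B \<in> \<F>" by (simp add: \<F>_def)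
      moreover have "\<forall>X\<in>C. X \<subseteq> ev (Inf B)"
        by (auto simp: C_img ev_mono intro: Inf_lower)
      ultimately show ?thesis by blast
    qed
  qed
  then obtain F where F: "F \<in> \<F>" and max: "\<And>G. G \<in> \<F> \<Longrightarrow> G \<le> F \<Longrightarrow> F \<le> G"
    using ev_mono by (smt (verit, best) image_iff order_refl)
  have "eventually P F \<or> eventually (\<lambda>n. \<not> P n) F" for P
  proof (rule disjCI)
    let ?G = "inf F (principal {n. P n})"
    assume "\<not> eventually (\<lambda>n. \<not> P n) F"
    then have "?G \<noteq> bot"
      by (simp add: trivial_limit_def eventually_inf_principal)
    then have "F \<le> ?G"
      using F by (intro max) (auto simp: \<F>_def intro: le_infI1)
    then show "eventually P F"
      by (simp add: le_principal)
  qed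
  then show ?thesis using F by (auto simp: nonprincipal_ultrafilter_def \<F>_def)
qed

text \<open>\<open>cone_dist\<close> is a \<open>Lim\<close>, which carries information only where
  the limit exists. Compactness yields a cluster point \<open>l\<close>. The ultrafilter decides
  each neighbourhood of \<open>l\<close>, and it cannot choose the complement.\<close>

lemma ultrafilter_convergent:
  fixes f :: "nat \<Rightarrow> real"
  assumes "nonprincipal_ultrafilter \<omega>" and bounded: "eventually (\<lambda>n. \<bar>f n\<bar> \<le> C) \<omega>"
  shows "(f \<longlongrightarrow> Lim \<omega> f) \<omega>"
proof -
  have ne: "\<omega> \<noteq> bot" and ultra: "\<And>P. eventually P \<omega> \<or> eventually (\<lambda>n. \<not> P n) \<omega>"
    using assms(1) by (auto simp: nonprincipal_ultrafilter_def)
  have "compact {-C..C}" by simp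
  moreover have "filtermap f \<omega> \<noteq> bot" using ne by (simp add: filtermap_bot_iff)
  moreover have "eventually (\<lambda>x. x \<in> {-C..C}) (filtermap f \<omega>)"
    using bounded by (auto simp: eventually_filtermap abs_le_iff elim!: eventually_mono)
  ultimately obtain l where l: "inf (nhds l) (filtermap f \<omega>) \<noteq> bot"
    unfolding compact_filter by blast
  have "(f \<longlongrightarrow> l) \<omega>"
  proof (rule topological_tendstoI, rule ccontr)
    fix S assume S: "open S" "l \<in> S" "\<not> eventually (\<lambda>n. f n \<in> S) \<omega>"
    then have "eventually (\<lambda>x. x \<notin> S) (filtermap f \<omega>)"
      using ultra[of "\<lambda>n. f n \<in> S"] by (simp add: eventually_filtermap)
    moreover have "eventually (\<lambda>x. x \<in> S) (nhds l)"
      using S by (simp add: eventually_nhds_in_open)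
    ultimately have "eventually (\<lambda>x. False) (inf (nhds l) (filtermap f \<omega>))"
      unfolding eventually_inf by blast
    then show False using l by (simp add: trivial_limit_def)
  qed
  then show ?thesis using ne tendsto_Lim by metis
qed

text \<open>The equality \<open>proj\<close> says that the distance from \<open>x\<close> along the
  ray falls with slope one until the index \<open>k x\<close> and rises with slope one afterwards.
  In particular the ray is geodesic. \<open>contract\<close> is strong contraction: moving the
  projection by \<open>M\<close> costs at least the distance to the ray.\<close>

locale contracting_ray =
  fixes X :: "'a set" and d :: "'a \<Rightarrow> 'a \<Rightarrow> real" and a :: "nat \<Rightarrow> 'a" and k :: "'a \<Rightarrow> nat"
    and M :: nat
  assumes a_in [simp]: "a i \<in> X"
    and nonneg: "x \<in> X \<Longrightarrow> y \<in> X \<Longrightarrow> 0 \<le> d x y"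
    and refl0: "x \<in> X \<Longrightarrow> d x x = 0"
    and commute: "x \<in> X \<Longrightarrow> y \<in> X \<Longrightarrow> d x y = d y x"
    and triangle: "x \<in> X \<Longrightarrow> y \<in> X \<Longrightarrow> z \<in> X \<Longrightarrow> d x z \<le> d x y + d y z"
    and proj: "x \<in> X \<Longrightarrow> d x (a i) = d x (a (k x)) + \<bar>real i - real (k x)\<bar>"
    and contract: "x \<in> X \<Longrightarrow> y \<in> X \<Longrightarrow> k x + M \<le> k y \<Longrightarrow> d x (a (k x)) \<le> d x y"
    and M: "3 \<le> M"
begin

lemma k_a [simp]: "k (a i) = i"
  using proj[of "a i" i] nonneg[of "a i" "a (k (a i))"] refl0[of "a i"] by simp

lemma d_a: "d (a i) (a j) = \<bar>real i - real j\<bar>"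
  using proj[of "a i" j] by (simp add: refl0 abs_minus_commute)

text \<open>The distances from \<open>x\<close> and from \<open>y\<close> are compared at
  \<open>a 0\<close> and at a ray point beyond both projections. The projections enter the two
  differences with opposite signs, so subtracting isolates \<open>2 * (k y - k x)\<close>.\<close>

lemma k_lipschitz:
  assumes "x \<in> X" "y \<in> X"
  shows "\<bar>real (k x) - real (k y)\<bar> \<le> d x y"
proof -
  define i where "i = k x + k y"
  have diff: "\<bar>d x (a j) - d y (a j)\<bar> \<le> d x y" for j
    using triangle[of x y "a j"] triangle[of y x "a j"] commute[of x y] assms by simp
  have "d x (a i) = d x (a (k x)) + real (k y)" "d x (a 0) = d x (a (k x)) + real (k x)"
    "d y (a i) = d y (a (k y)) + real (k x)" "d y (a 0) = d y (a (k y)) + real (k y)"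
    using assms proj[of x i] proj[of y i] proj[of x 0] proj[of y 0] by (simp_all add: i_def)
  then show ?thesis using diff[of i] diff[of 0] by linarith
qed

lemma not_wide: "\<not> wide X d"
proof -
  obtain \<omega> where \<omega>: "nonprincipal_ultrafilter \<omega>" using ex_nonprincipal_ultrafilter ..
  then have ne: "\<omega> \<noteq> bot" and seq: "\<omega> \<le> sequentially"
    and ultra: "\<And>P. eventually P \<omega> \<or> eventually (\<lambda>n. \<not> P n) \<omega>"
    by (auto simp: nonprincipal_ultrafilter_def)
  have seqI: "eventually P \<omega>" if "eventually P sequentially" for P
    using seq that by (auto simp: le_filter_def)
  \<comment> \<open>The base point at time \<open>n\<close> is \<open>a n\<close>. A scale
    comparable to \<open>n\<close> keeps the start \<open>a 0\<close> of the ray visible in the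
    cone, at distance 1 from the base point.\<close>
  define s where "s = (\<lambda>n. real (Suc n))"
  have s_pos: "s n > 0" for n by (simp add: s_def)
  have s_top: "filterlim s at_top \<omega>"
  proof (rule filterlim_mono[OF _ order_refl seq])
    show "filterlim s at_top sequentially"
      unfolding s_def
      by (rule filterlim_compose[OF filterlim_real_sequentially filterlim_Suc])
  qed
  define P where "P = cone_pts X d \<omega> s a"
  define D where "D = cone_dist d \<omega> s"
  define Y where "Y = {x \<in> P. D x a > 0}"
  have P_X: "x n \<in> X" if "x \<in> P" for x n
    using that by (simp add: P_def cone_pts_def)
  have D_lim: "((\<lambda>n. d (x n) (y n) / s n) \<longlongrightarrow> D x y) \<omega>" if xy: "x \<in> P" "y \<in> P" for x y
  proof -
    obtain A B where "eventually (\<lambda>n. d (a n) (x n) / s n \<le> A) \<omega>"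
      "eventually (\<lambda>n. d (a n) (y n) / s n \<le> B) \<omega>"
      using xy by (auto simp: P_def cone_pts_def)
    then have "eventually (\<lambda>n. \<bar>d (x n) (y n) / s n\<bar> \<le> A + B) \<omega>"
    proof eventually_elim
      case (elim n)
      have "d (x n) (y n) \<le> d (a n) (x n) + d (a n) (y n)"
        using triangle[of "x n" "a n" "y n"] commute[of "x n" "a n"] xy by (simp add: P_X)
      then have "d (x n) (y n) / s n \<le> (d (a n) (x n) + d (a n) (y n)) / s n"
        using s_pos[of n] by (simp add: divide_right_mono)
      then have "d (x n) (y n) / s n \<le> A + B"
        using elim by (simp add: add_divide_distrib)
      then show ?case using nonneg[of "x n" "y n"] s_pos[of n] xy by (simp add: P_X)
    qed
    from ultrafilter_convergent[OF \<omega> this] show ?thesis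
      by (simp add: D_def cone_dist_def)
  qed
  have D_less: "eventually (\<lambda>n. d (x n) (y n) < e * s n) \<omega>"
    if "x \<in> P" "y \<in> P" "D x y < e" for x y e
    using order_tendstoD(2)[OF D_lim[OF that(1,2)] that(3)] s_pos
    by (simp add: divide_less_eq)
  have D_greater: "eventually (\<lambda>n. d (x n) (y n) > e * s n) \<omega>"
    if "x \<in> P" "y \<in> P" "e < D x y" for x y e
    using order_tendstoD(1)[OF D_lim[OF that(1,2)] that(3)] s_pos
    by (simp add: less_divide_eq)
  have a_P: "a \<in> P" by (auto simp: P_def cone_pts_def refl0 intro!: exI[of _ 0])
  \<comment> \<open>The projection lies beyond the base point by a positive amount in the cone. This
    set is open because \<open>k\<close> is Lipschitz; openness of its complement in
    \<open>Y\<close> needs contraction.\<close>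
  define right where
    "right = (\<lambda>x :: nat \<Rightarrow> 'a. \<exists>e>0. eventually (\<lambda>n. real (k (x n)) \<ge> real n + e * s n) \<omega>)"
  define U where "U = {x \<in> Y. right x}"
  define V where "V = {x \<in> Y. \<not> right x}"
  have "pm_open Y D U"
    unfolding pm_open_def
  proof (intro conjI ballI)
    show "U \<subseteq> Y" by (auto simp: U_def)
    fix x assume x: "x \<in> U"
    then obtain e where e: "e > 0" "eventually (\<lambda>n. real (k (x n)) \<ge> real n + e * s n) \<omega>"
      by (auto simp: U_def right_def)
    have "y \<in> U" if y: "y \<in> Y" "D x y < e / 2" for y
    proof -
      have P: "x \<in> P" "y \<in> P" using x y by (auto simp: U_def Y_def)
      have "eventually (\<lambda>n. real (k (y n)) \<ge> real n + e / 2 * s n) \<omega>"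
        using e(2) D_less[OF P y(2)]
      proof eventually_elim
        case (elim n)
        then show ?case using k_lipschitz[of "x n" "y n"] P by (simp add: P_X)
      qed
      then show ?thesis using y e(1) by (auto simp: U_def right_def intro!: exI[of _ "e / 2"])
    qed
    then show "\<exists>e>0. \<forall>y\<in>Y. D x y < e \<longrightarrow> y \<in> U"
      using e(1) by (intro exI[of _ "e / 2"]) auto
  qed
  moreover have "pm_open Y D V"
    unfolding pm_open_def
  proof (intro conjI ballI)
    show "V \<subseteq> Y" by (auto simp: V_def)
    fix x assume x: "x \<in> V"
    define r where "r = D x a"
    have r: "r > 0" and xP: "x \<in> P" using x by (auto simp: V_def Y_def r_def)
    \<comment> \<open>If \<open>y\<close> were on the right, the projections of \<open>x\<close> and
      \<open>y\<close> would be more than \<open>M\<close> apart, so \<open>x\<close> would be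
      within \<open>r / 4\<close> (times the scale) of its projection. That projection is within
      \<open>r / 4\<close> of the base point, by \<open>k_lipschitz\<close> on one side and by the
      choice of \<open>e'\<close> on the other. Together this contradicts the distance
      \<open>r\<close>.\<close>
    have "y \<in> V" if y: "y \<in> Y" "D x y < r / 4" for y
    proof (rule ccontr)
      assume "y \<notin> V"
      then obtain e where e: "e > 0" "eventually (\<lambda>n. real (k (y n)) \<ge> real n + e * s n) \<omega>"
        using y by (auto simp: V_def right_def)
      have yP: "y \<in> P" using y by (simp add: Y_def)
      define e' where "e' = min e r / 4"
      have e': "e' > 0" "e' \<le> e / 4" "e' \<le> r / 4" using e(1) r by (auto simp: e'_def)
      have "\<not> eventually (\<lambda>n. real (k (x n)) \<ge> real n + e' * s n) \<omega>"
        using x e' by (auto simp: V_def right_def)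
      then have left: "eventually (\<lambda>n. real (k (x n)) < real n + e' * s n) \<omega>"
        using ultra[of "\<lambda>n. real (k (x n)) \<ge> real n + e' * s n"] by (simp add: not_le)
      have "eventually (\<lambda>n. s n \<ge> real M / (e / 2)) \<omega>"
        using s_top by (simp add: filterlim_at_top)
      moreover have "3 / 4 * r < D x a" using r by (simp add: r_def)
      note D_greater[OF xP a_P this]
      ultimately have "eventually (\<lambda>n. False) \<omega>"
        using e(2) left D_less[OF xP yP y(2)]
      proof eventually_elim
        case (elim n)
        have X: "x n \<in> X" "y n \<in> X" using xP yP by (auto simp: P_X)
        have "real M \<le> e / 2 * s n" using elim(1) e(1) by (simp add: field_simps)
        moreover have "e' * s n \<le> e / 4 * s n" "e' * s n \<le> r / 4 * s n" "e / 4 * s n > 0" "r * s n > 0"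
          using e' r e(1) s_pos[of n] by (auto intro!: mult_right_mono)
        ultimately have "k (x n) + M \<le> k (y n)" using elim by linarith
        then have "d (x n) (a (k (x n))) \<le> d (x n) (y n)"
          using X by (intro contract)
        then show False
          using proj[OF X(1), of n] elim k_lipschitz[OF X] \<open>e' * s n \<le> r / 4 * s n\<close> \<open>e' * s n \<le> e / 4 * s n\<close>
            \<open>r * s n > 0\<close> \<open>e / 4 * s n > 0\<close>
          by linarith
      qed
      then show False using ne by simp
    qed
    then show "\<exists>e>0. \<forall>y\<in>Y. D x y < e \<longrightarrow> y \<in> V"
      using r by (intro exI[of _ "r / 4"]) auto
  qed
  moreover have "U \<noteq> {}"
  proof -
    \<comment> \<open>The distance to \<open>a n\<close> is \<open>n + 1\<close>, exactly the
      scale.\<close>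
    define x where "x = (\<lambda>n. a (Suc (2 * n)))"
    have x: "x \<in> P"
      unfolding P_def cone_pts_def x_def by (auto simp: d_a s_def intro!: exI[of _ 1])
    moreover have "1 = D x a"
    proof (rule tendsto_unique[OF ne _ D_lim[OF x a_P]])
      have "(\<lambda>n. d (x n) (a n) / s n) = (\<lambda>n. 1)"
        by (rule ext) (simp add: x_def d_a s_def)
      then show "((\<lambda>n. d (x n) (a n) / s n) \<longlongrightarrow> 1) \<omega>" by simp
    qed
    moreover have "right x"
      by (auto simp: right_def x_def s_def intro!: exI[of _ 1])
    ultimately have "x \<in> U" by (auto simp: U_def Y_def)
    then show ?thesis by blast
  qed
  moreover have "V \<noteq> {}"
  proof -
    define x :: "nat \<Rightarrow> 'a" where "x = (\<lambda>n. a 0)"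
    have x: "x \<in> P"
      unfolding P_def cone_pts_def x_def by (auto simp: d_a s_def intro!: exI[of _ 1])
    moreover have "1 = D x a"
    proof (rule tendsto_unique[OF ne _ D_lim[OF x a_P]])
      have "(\<lambda>n. d (x n) (a n) / s n) = (\<lambda>n. real n / real (Suc n))"
        by (rule ext) (simp add: x_def d_a s_def)
      then show "((\<lambda>n. d (x n) (a n) / s n) \<longlongrightarrow> 1) \<omega>"
        using tendsto_mono[OF seq LIMSEQ_n_over_Suc_n] by simp
    qed
    moreover have "\<not> right x"
    proof
      assume "right x"
      then obtain e where "e > 0" "eventually (\<lambda>n. 0 \<ge> real n + e * s n) \<omega>"
        by (auto simp: right_def x_def)
      moreover have "\<not> 0 \<ge> real n + e * s n" if "e > 0" for n
        using that s_pos[of n] by (simp add: not_le add_nonneg_pos)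
      ultimately show False using ne by simp
    qed
    ultimately have "x \<in> V" by (auto simp: V_def Y_def)
    then show ?thesis by blast
  qed
  moreover have "U \<inter> V = {}" "Y \<subseteq> U \<union> V" by (auto simp: U_def V_def)
  ultimately have "pm_disconnected Y D" unfolding pm_disconnected_def by blast
  then have "has_cut_point X d \<omega> s a"
    unfolding has_cut_point_def using a_P by (auto simp: Y_def P_def D_def)
  then show ?thesis unfolding wide_def using \<omega> s_pos s_top a_in by blast
qed

text \<open>Only the \<open>r\<close> segments of length \<open>M\<close> just beyond the centre
  \<open>a R\<close>, with \<open>R = 4 * M * r\<close>, are used. They end at
  \<open>R + R / 4\<close>, so a path point projecting into them is at least
  \<open>R / 4 - 2\<close> away from the ray, and contraction charges this amount for each segment
  crossed.\<close>

lemma avoiding_path_length: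
  assumes path: "is_path X d (a 0) (a (2 * (4 * M * r))) p"
    and avoid: "\<forall>z\<in>set p. d (a (4 * M * r)) z \<ge> real (4 * M * r) / 2 - 2"
  shows "r * r \<le> length p - 1"
proof -
  define R where "R = 4 * M * r"
  have p0: "p ! 0 = a 0" and pl: "p ! (length p - 1) = a (2 * R)" and ne: "p \<noteq> []"
    using path by (auto simp: is_path_def hd_conv_nth last_conv_nth R_def)
  have pX: "p ! i \<in> X" "p ! i \<in> set p" if "i < length p" for i
    using that path by (auto simp: is_path_def)
  have step: "d (p ! i) (p ! Suc i) \<le> 1" if "i < length p - 1" for i
    using that path by (auto simp: is_path_def)
  have sub: "d (p ! i) (p ! (i + m)) \<le> m" if "i + m < length p" for i m
    using that
  proof (induction m)
    case 0
    then show ?case by (simp add: refl0 pX)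
  next
    case (Suc m)
    then have "d (p ! i) (p ! (i + Suc m)) \<le> d (p ! i) (p ! (i + m)) + d (p ! (i + m)) (p ! (i + Suc m))"
      by (intro triangle pX) auto
    moreover have "d (p ! (i + m)) (p ! Suc (i + m)) \<le> 1"
      using Suc.prems by (intro step) simp
    ultimately show ?case using Suc by simp
  qed
  \<comment> \<open>The projection starts at 0 and changes by at most one per edge, so it skips no
    index.\<close>
  have ivt: "\<exists>i\<le>n. k (p ! i) = h" if "n < length p" "h \<le> k (p ! n)" for n h
  proof -
    have "\<exists>i\<le>n. int (k (p ! i)) = int h"
    proof (rule nat0_intermed_int_val)
      show "\<forall>i<n. \<bar>int (k (p ! (i + 1))) - int (k (p ! i))\<bar> \<le> 1"
      proof (intro allI impI)
        fix i assume i: "i < n"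
        have "\<bar>real (k (p ! i)) - real (k (p ! Suc i))\<bar> \<le> 1"
          using order_trans[OF k_lipschitz step] pX i that by simp
        then show "\<bar>int (k (p ! (i + 1))) - int (k (p ! i))\<bar> \<le> 1" by simp
      qed
    qed (use that p0 in auto)
    then show ?thesis by auto
  qed
  \<comment> \<open>A clock: reaching the end of the \<open>j\<close>-th segment takes at least
    \<open>j * r\<close> steps. In the induction \<open>T1\<close> and \<open>T2\<close> are times
    at which the projection is at the two ends of the last segment.\<close>
  have late: "j * r \<le> T" if "T < length p" "R + j * M \<le> k (p ! T)" "j \<le> r" for j T
    using that
  proof (induction j arbitrary: T)
    case 0
    then show ?case by simp
  next
    case (Suc j)
    obtain T1 where T1: "T1 \<le> T" "k (p ! T1) = R + Suc j * M"
      using ivt[OF Suc.prems(1,2)] by auto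
    have T1_len: "T1 < length p" using T1 Suc by simp
    obtain T2 where T2: "T2 \<le> T1" "k (p ! T2) = R + j * M"
      using ivt[OF T1_len, of "R + j * M"] T1 by auto
    have T2_len: "T2 < length p" using T2 T1_len by simp
    have "j * r \<le> T2" using T2 T2_len Suc by simp
    moreover have "r \<le> T1 - T2"
    proof -
      note X = pX(1)[OF T1_len] pX[OF T2_len]
      \<comment> \<open>The factor 3 absorbs the additive 2 of the avoided ball:
        \<open>r * M - 2 \<ge> 3 * r - 2 \<ge> r\<close>, since \<open>r\<close> is at least 1
        here.\<close>
      have "real r * 3 \<le> real r * real M" using M by (intro mult_left_mono) auto
      moreover have "real j * real M \<le> real r * real M" "1 \<le> real r"
        using Suc.prems(3) by (auto intro: mult_right_mono)
      moreover have "d (p ! T2) (a R) = d (p ! T2) (a (R + j * M)) + real j * real M"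
        using proj[OF X(2), of R] T2 by simp
      moreover have "d (p ! T2) (a R) \<ge> real R / 2 - 2"
        using avoid X commute[of "p ! T2" "a R"] by (simp add: R_def)
      moreover have "d (p ! T2) (a (R + j * M)) \<le> d (p ! T2) (p ! T1)"
        using contract[OF X(2,1)] T1 T2 by simp
      moreover have "d (p ! T2) (p ! T1) \<le> real (T1 - T2)"
        using sub[of T2 "T1 - T2"] T2 T1_len by simp
      moreover have "real R = 4 * (real r * real M)" by (simp add: R_def)
      ultimately have "real r \<le> real (T1 - T2)" by linarith
      then show ?thesis by simp
    qed
    ultimately show ?case using T1 T2 by simp
  qed
  show ?thesis
    using late[of "length p - 1" r] pl ne by (simp add: R_def)
qed

text \<open>The witnesses are two ray points at distance \<open>R\<close> on either side of the
  centre \<open>a R\<close>, so that the avoided ball has radius \<open>R / 2 - 2\<close>. If no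
  path avoids it, the infimum is infinite.\<close>

lemma Div_ge:
  assumes "real (2 * (4 * M * r)) \<le> t"
  shows "ereal (real (r * r)) \<le> Div X d (1/2) 2 t"
proof -
  let ?R = "4 * M * r"
  have "ereal (real (r * r)) \<le> div_pt X d (1/2) 2 (a 0) (a (2 * ?R)) (a ?R)"
    unfolding div_pt_def
  proof (rule Inf_greatest, clarify)
    fix p assume p: "is_path X d (a 0) (a (2 * ?R)) p"
      "\<forall>z\<in>set p. d (a ?R) z \<ge> 1 / 2 * min (d (a ?R) (a 0)) (d (a ?R) (a (2 * ?R))) - 2"
    have "min (d (a ?R) (a 0)) (d (a ?R) (a (2 * ?R))) = real ?R" by (simp add: d_a)
    then have "r * r \<le> length p - 1"
      using p by (intro avoiding_path_length) auto
    then show "ereal (real (r * r)) \<le> ereal (real (length p - 1))"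
      by (simp only: ereal_less_eq of_nat_le_iff)
  qed
  also have "\<dots> \<le> Div X d (1/2) 2 t"
    unfolding Div_def using assms by (intro Sup_upper) (fastforce simp: d_a)
  finally show ?thesis .
qed

lemma at_least_quadratic: "at_least_quadratic_div X d"
  unfolding at_least_quadratic_div_def
proof (intro exI conjI allI impI)
  \<comment> \<open>The two endpoints in \<open>Div_ge\<close> are \<open>8 * M * r\<close> apart.
    Rounding \<open>t\<close> up to \<open>r\<close> adds at most one more \<open>8 * M\<close>,
    which is the additive constant.\<close>
  let ?C = "real (8 * M)"
  show "?C > 0" using M by simp
  fix t :: real assume t: "t \<ge> 0"
  define r where "r = nat \<lceil>t\<rceil>"
  have r: "t \<le> real r" "real r \<le> t + 1" using t by (auto simp: r_def)
  have "real (2 * (4 * M * r)) = ?C * real r" by simp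
  also have "\<dots> \<le> ?C * (t + 1)" using r by (intro mult_left_mono) auto
  finally have D: "ereal (real (r * r)) \<le> Div X d (1/2) 2 (?C * t + ?C)"
    by (intro Div_ge) (simp add: distrib_left)
  have "t\<^sup>2 \<le> real (r * r)" using r t by (simp add: power2_eq_square mult_mono)
  then have "ereal (t\<^sup>2) \<le> 1 * ereal (real (r * r))" by simp
  also have "\<dots> \<le> ereal ?C * Div X d (1/2) 2 (?C * t + ?C)"
    using D M by (intro ereal_mult_mono) (auto simp: one_ereal_def)
  also have "\<dots> \<le> \<dots> + ereal (?C * t + ?C)"
    using t by (intro ereal_le_add_self) simp
  finally show "ereal (t\<^sup>2) \<le> ereal ?C * Div X d (1/2) 2 (?C * t + ?C) + ereal (?C * t + ?C)" .
qed

end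

section \<open>Reduced words in right-angled Coxeter groups\<close>

lemma racg_eq_refl [simp]: "racg_eq E u u"
  by (simp add: racg_eq_def)

lemma racg_eq_sym: "racg_eq E u v \<Longrightarrow> racg_eq E v u"
  unfolding racg_eq_def
  by (induction rule: rtranclp_induct) (auto intro: converse_rtranclp_into_rtranclp)

lemma racg_eq_trans [trans]: "racg_eq E u v \<Longrightarrow> racg_eq E v w \<Longrightarrow> racg_eq E u w"
  unfolding racg_eq_def by (rule rtranclp_trans)

lemma racg_eq_map:
  assumes step: "\<And>u v. racg_step E u v \<Longrightarrow> racg_eq E (f u) (f v)" and "racg_eq E u v"
  shows "racg_eq E (f u) (f v)"
proof -
  have "(\<lambda>u v. racg_step E u v \<or> racg_step E v u)\<^sup>*\<^sup>* u v"
    using assms(2) by (simp add: racg_eq_def)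
  then show ?thesis
  proof (induction rule: rtranclp_induct)
    case (step y z)
    then have "racg_eq E (f y) (f z)" using assms(1) racg_eq_sym by blast
    with step.IH show ?case by (rule racg_eq_trans)
  qed simp
qed

lemma racg_eq_step: "racg_step E u v \<Longrightarrow> racg_eq E u v"
  unfolding racg_eq_def by blast

lemma racg_eq_context: "racg_eq E u v \<Longrightarrow> racg_eq E (x @ u @ y) (x @ v @ y)"
proof (rule racg_eq_map[where f = "\<lambda>u. x @ u @ y"])
  fix u v assume "racg_step E u v"
  then show "racg_eq E (x @ u @ y) (x @ v @ y)"
  proof cases
    case (del x' s y')
    then show ?thesis using racg_step.del[of E "x @ x'" s "y' @ y"] by (auto intro: racg_eq_step)
  next
    case (comm s t x' y')
    then show ?thesis
      using racg_step.comm[of s t E "x @ x'" "y' @ y"] by (auto intro: racg_eq_step)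
  qed
qed

lemma racg_eq_append:
  assumes "racg_eq E u u'" "racg_eq E v v'"
  shows "racg_eq E (u @ v) (u' @ v')"
  using racg_eq_context[OF assms(1), of "[]" v] racg_eq_context[OF assms(2), of u' "[]"]
  by (auto intro: racg_eq_trans)

lemma racg_eq_rev: "racg_eq E u v \<Longrightarrow> racg_eq E (rev u) (rev v)"
proof (rule racg_eq_map[where f = rev])
  fix u v assume "racg_step E u v"
  then show "racg_eq E (rev u) (rev v)"
  proof cases
    case (del x s y)
    then show ?thesis using racg_step.del[of E "rev y" s "rev x"] by (auto intro: racg_eq_step)
  next
    case (comm s t x y)
    then show ?thesis
      using racg_step.comm[of t s E "rev y" "rev x"]
      by (auto simp: insert_commute intro: racg_eq_step)
  qed
qed

lemma racg_eq_square: "racg_eq E [s, s] []"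
  using racg_step.del[of E "[]" s "[]"] by (auto intro: racg_eq_step)

lemma racg_eq_rev_append: "racg_eq E (u @ rev u) []"
proof (induction u)
  case (Cons s u)
  have "racg_eq E ([s] @ (u @ rev u) @ [s]) ([s] @ [] @ [s])"
    using Cons by (rule racg_eq_context)
  then show ?case using racg_eq_square by (auto intro: racg_eq_trans)
qed simp

lemma racg_eq_commute_past:
  assumes "\<forall>t\<in>set y. {s, t} \<in> E"
  shows "racg_eq E (s # y) (y @ [s])"
  using assms
proof (induction y)
  case (Cons t y)
  have "racg_eq E (s # t # y) (t # s # y)"
    using Cons.prems racg_step.comm[of s t E "[]" y] by (auto intro: racg_eq_step)
  also have "racg_eq E (t # s # y) (t # y @ [s])"
    using Cons racg_eq_context[of E "s # y" "y @ [s]" "[t]" "[]"] by auto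
  finally show ?case by simp
qed simp

lemma racg_eq_cancel:
  assumes "\<forall>t\<in>set y. {s, t} \<in> E"
  shows "racg_eq E (x @ s # y @ [s]) (x @ y)"
proof -
  have "racg_eq E ((s # y) @ [s]) ((y @ [s]) @ [s])"
    using racg_eq_append[OF racg_eq_commute_past[OF assms]] racg_eq_refl by blast
  also have "racg_eq E \<dots> (y @ [])"
    using racg_eq_append[OF racg_eq_refl racg_eq_square, of E y s] by simp
  finally show ?thesis
    using racg_eq_append[OF racg_eq_refl[of E x]] by fastforce
qed

text \<open>Mozes' numbers game, i.e. the dual geometric representation: the charge \<open>charge E w s\<close>
  is the value at the simple root of \<open>s\<close> of a dominant functional moved by \<open>w\<close>,
  and it is negative iff \<open>s\<close> is a right descent of \<open>w\<close>.\<close>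

definition fire :: "nat set set \<Rightarrow> nat \<Rightarrow> (nat \<Rightarrow> int) \<Rightarrow> nat \<Rightarrow> int" where
  "fire E s c = (\<lambda>t. if t = s then - c s else if {s, t} \<in> E then c t else c t + 2 * c s)"

definition charge :: "nat set set \<Rightarrow> nat list \<Rightarrow> nat \<Rightarrow> int" where
  "charge E w = fold (fire E) w (\<lambda>_. 1)"

definition reduced :: "nat set set \<Rightarrow> nat list \<Rightarrow> bool" where
  "reduced E w \<longleftrightarrow> (\<forall>i<length w. charge E (take i w) (w ! i) > 0)"

text \<open>The invariant of the game. Two non-commuting generators span an infinite dihedral group;
  firing either one preserves the sum of their charges, so they are never both descents.\<close>

definition regular :: "nat set set \<Rightarrow> (nat \<Rightarrow> int) \<Rightarrow> bool" where
  "regular E c \<longleftrightarrow> (\<forall>s. c s \<noteq> 0) \<and> (\<forall>s t. s \<noteq> t \<longrightarrow> {s, t} \<notin> E \<longrightarrow> c s + c t > 0)"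

definition word_length :: "nat \<Rightarrow> nat set set \<Rightarrow> nat list \<Rightarrow> nat" where
  "word_length n E u = (LEAST k. \<exists>w \<in> racg_words n. length w = k \<and> racg_eq E u w)"

lemma racg_dist_word_length: "racg_dist n E u v = real (word_length n E (rev u @ v))"
  by (simp add: racg_dist_def word_length_def)

lemma racg_words_simps [simp]:
  "[] \<in> racg_words n" "s # u \<in> racg_words n \<longleftrightarrow> s < n \<and> u \<in> racg_words n"
  "u @ v \<in> racg_words n \<longleftrightarrow> u \<in> racg_words n \<and> v \<in> racg_words n"
  "rev u \<in> racg_words n \<longleftrightarrow> u \<in> racg_words n"
  by (auto simp: racg_words_def)

lemma charge_Nil [simp]: "charge E [] = (\<lambda>_. 1)"
  by (simp add: charge_def)

lemma charge_snoc: "charge E (w @ [s]) = fire E s (charge E w)"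
  by (simp add: charge_def)

lemma reduced_Nil [simp]: "reduced E []"
  by (simp add: reduced_def)

lemma reduced_snoc: "reduced E (w @ [s]) \<longleftrightarrow> reduced E w \<and> charge E w s > 0"
  by (auto simp: reduced_def nth_append less_Suc_eq)

text \<open>Since \<open>{s, s}\<close> is \<open>{s}\<close>, excluding loops makes every letter
  non-adjacent to itself. Hence a condition \<open>{s, t} \<in> E\<close> also says that
  \<open>t\<close> differs from \<open>s\<close>.\<close>

locale coxeter_graph =
  fixes n :: nat and E :: "nat set set"
  assumes no_loop [simp]: "{s} \<notin> E"
begin

section \<open>Charges, the exchange property and reduced words\<close>

lemma fire_square: "fire E s (fire E s c) = c"
  by (auto simp: fire_def fun_eq_iff)

lemma fire_commute:
  assumes "{s, t} \<in> E"
  shows "fire E s (fire E t c) = fire E t (fire E s c)"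
proof -
  have "s \<noteq> t" "{t, s} \<in> E" using assms by (auto simp: insert_commute)
  then show ?thesis using assms by (auto simp: fire_def fun_eq_iff)
qed

lemma charge_cong:
  assumes "racg_eq E u v"
  shows "charge E u = charge E v"
proof -
  have step: "charge E u = charge E v" if "racg_step E u v" for u v
    using that
  proof cases
    case (comm s t x y)
    then show ?thesis by (simp add: charge_def fire_commute[of s t])
  qed (simp add: charge_def fire_square)
  show ?thesis
    using assms unfolding racg_eq_def
    by (induction rule: rtranclp_induct) (auto dest: step)
qed

text \<open>Firing a positive charge lowers no other charge and keeps the sum of \<open>s\<close>
  with any non-neighbour. A changed charge becomes \<open>(c s + c t) + c s\<close>, which is
  positive.\<close>

lemma regular_fire:
  assumes c: "regular E c" and pos: "c s > 0"
  shows "regular E (fire E s c)"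
proof -
  have up: "t = s \<or> c t \<le> fire E s c t" for t
    using pos by (simp add: fire_def)
  have "fire E s c t \<noteq> 0" for t
  proof (cases "t = s \<or> {s, t} \<in> E")
    case True
    then show ?thesis using c by (auto simp: fire_def regular_def)
  next
    case False
    then have "c s + c t > 0" using c by (auto simp: regular_def)
    then show ?thesis using False pos by (simp add: fire_def)
  qed
  moreover have "fire E s c t + fire E s c u > 0" if "t \<noteq> u" "{t, u} \<notin> E" for t u
  proof -
    have sum: "c t + c u > 0" using c that by (auto simp: regular_def)
    consider "t = s" | "u = s" | "t \<noteq> s" "u \<noteq> s" by blast
    then show ?thesis
    proof cases
      case 1
      then show ?thesis using that sum by (simp add: fire_def)
    next
      case 2
      then show ?thesis using that sum by (auto simp: fire_def insert_commute)
    next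
      case 3
      then show ?thesis using up[of t] up[of u] sum by linarith
    qed
  qed
  ultimately show ?thesis by (auto simp: regular_def)
qed

lemma regular_reduced: "reduced E w \<Longrightarrow> regular E (charge E w)"
proof (induction w rule: rev_induct)
  case Nil
  then show ?case by (simp add: regular_def)
next
  case (snoc s w)
  then show ?case by (simp add: reduced_snoc charge_snoc regular_fire)
qed

text \<open>Peel off the last letter \<open>t\<close>. If it differs from \<open>s\<close> and does
  not commute with \<open>s\<close>, regularity would make the charge of \<open>s\<close> positive
  after firing \<open>t\<close>. So \<open>t\<close> commutes with \<open>s\<close>, and the charge
  of \<open>s\<close> was negative before it.\<close>

lemma exchange:
  assumes "reduced E w" "charge E w s < 0"
  shows "\<exists>u v. w = u @ s # v \<and> (\<forall>t\<in>set v. {s, t} \<in> E)"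
  using assms
proof (induction w rule: rev_induct)
  case (snoc t w)
  then have red: "reduced E w" and pos: "charge E w t > 0" by (auto simp: reduced_snoc)
  show ?case
  proof (cases "s = t")
    case True
    then show ?thesis by force
  next
    case ne: False
    have adj: "{t, s} \<in> E"
    proof (rule ccontr)
      assume "{t, s} \<notin> E"
      then have "charge E w t + charge E w s > 0"
        using regular_reduced[OF red] ne by (auto simp: regular_def)
      then show False
        using snoc.prems pos ne \<open>{t, s} \<notin> E\<close> by (simp add: charge_snoc fire_def)
    qed
    then have "charge E w s < 0"
      using snoc.prems ne by (simp add: charge_snoc fire_def)
    then obtain u v where "w = u @ s # v" "\<forall>r\<in>set v. {s, r} \<in> E"
      using snoc.IH red by blast
    then show ?thesis
      using adj by (intro exI[of _ u] exI[of _ "v @ [t]"]) (auto simp: insert_commute)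
  qed
qed simp

lemma reduced_delete:
  assumes "reduced E (u @ s # v)" "\<forall>t\<in>set v. {s, t} \<in> E"
  shows "reduced E (u @ v)"
  using assms
proof (induction v rule: rev_induct)
  case Nil
  then show ?case by (simp add: reduced_snoc)
next
  case (snoc t v)
  have "reduced E ((u @ s # v) @ [t])" using snoc.prems by simp
  then have red: "reduced E (u @ s # v)" and pos: "charge E (u @ s # v) t > 0"
    unfolding reduced_snoc by auto
  have "racg_eq E (u @ s # v) (u @ v @ [s])"
    using racg_eq_append[OF racg_eq_refl racg_eq_commute_past] snoc.prems by simp
  then have "charge E (u @ s # v) = fire E s (charge E (u @ v))"
    using charge_cong charge_snoc[of E "u @ v" s] by simp
  moreover have "{s, t} \<in> E" using snoc.prems by simp
  then have "s \<noteq> t" by auto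
  ultimately have "charge E (u @ v) t > 0" using pos \<open>{s, t} \<in> E\<close> by (simp add: fire_def)
  then show ?case
    using snoc.IH[OF red] snoc.prems reduced_snoc[of E "u @ v" t] by simp
qed

text \<open>The combinatorial criterion: no two equal letters can be brought together by
  commutations. Once fired, a letter has negative charge, and letters commuting with it leave that
  charge alone; conversely \<open>exchange\<close> locates the cancelling partner. Unlike the
  charges, this form is visibly symmetric under reversal and suits concatenations.\<close>

lemma reduced_iff:
  "reduced E w \<longleftrightarrow> (\<forall>j<length w. \<forall>i<j. w ! i = w ! j \<longrightarrow> (\<exists>l. i < l \<and> l < j \<and> {w ! j, w ! l} \<notin> E))"
  (is "_ \<longleftrightarrow> ?Q w")
proof
  assume red: "reduced E w"
  show "?Q w"
  proof (intro allI impI, rule ccontr)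
    fix i j assume ij: "j < length w" "i < j" "w ! i = w ! j"
      and "\<not> (\<exists>l. i < l \<and> l < j \<and> {w ! j, w ! l} \<notin> E)"
    then have adj: "\<And>l. i < l \<Longrightarrow> l < j \<Longrightarrow> {w ! l, w ! j} \<in> E"
      by (auto simp: insert_commute)
    have "charge E (take l w) (w ! j) < 0" if "Suc i \<le> l" "l \<le> j" for l
      using that
    proof (induction l rule: dec_induct)
      case base
      have "charge E (take i w) (w ! j) > 0"
        using red[unfolded reduced_def, rule_format, of i] ij by simp
      then show ?case
        using ij by (simp add: take_Suc_conv_app_nth charge_snoc fire_def)
    next
      case (step l)
      have "{w ! l, w ! j} \<in> E" using adj step by simp
      moreover from this have "w ! j \<noteq> w ! l" by auto
      ultimately show ?case
        using step ij by (simp add: take_Suc_conv_app_nth charge_snoc fire_def)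
    qed
    from this[of j] show False using red ij unfolding reduced_def by fastforce
  qed
next
  assume "?Q w"
  then show "reduced E w"
  proof (induction w rule: rev_induct)
    case (snoc s w)
    have "?Q w"
    proof (intro allI impI)
      fix i j assume "j < length w" "i < j" "w ! i = w ! j"
      then show "\<exists>l. i < l \<and> l < j \<and> {w ! j, w ! l} \<notin> E"
        using snoc.prems[rule_format, of j i] by (auto simp: nth_append)
    qed
    then have red: "reduced E w" by (rule snoc.IH)
    have "\<not> charge E w s < 0"
    proof
      assume "charge E w s < 0"
      then obtain u v where uv: "w = u @ s # v" "\<forall>t\<in>set v. {s, t} \<in> E"
        using exchange red by blast
      then obtain l where l: "length u < l" "l < length w" "{s, w ! l} \<notin> E"
        using snoc.prems[rule_format, of "length w" "length u"]
        by (auto simp: nth_append split: if_splits)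
      then have "w ! l \<in> set v" using uv by (auto simp: nth_append nth_Cons')
      then show False using uv l by blast
    qed
    moreover have "charge E w s \<noteq> 0" using regular_reduced[OF red] by (simp add: regular_def)
    ultimately show ?case using red by (simp add: reduced_snoc)
  qed simp
qed

lemma reduced_rev:
  assumes "reduced E w"
  shows "reduced E (rev w)"
  unfolding reduced_iff
proof (intro allI impI)
  fix i j assume ij: "j < length (rev w)" "i < j" "rev w ! i = rev w ! j"
  define r where "r = (\<lambda>i. length w - Suc i)"
  have nth: "rev w ! m = w ! r m" if "m < length w" for m
    using that by (simp add: r_def rev_nth)
  have "r i < length w" "r j < r i" "w ! r j = w ! r i"
    using ij nth[of i] nth[of j] by (auto simp: r_def)
  then obtain l where l: "r j < l" "l < r i" "{w ! r i, w ! l} \<notin> E"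
    using assms unfolding reduced_iff by blast
  then have "i < r l" "r l < j" "rev w ! r l = w ! l" "rev w ! j = w ! r i"
    using ij nth[of "r l"] nth[of i] by (auto simp: r_def)
  then show "\<exists>l. i < l \<and> l < j \<and> {rev w ! j, rev w ! l} \<notin> E" using l by metis
qed

lemma reduced_suffix:
  assumes "reduced E (u @ v)"
  shows "reduced E v"
proof -
  have prefix: "reduced E u" if "reduced E (u @ v)" for u v
    using that by (induction v rule: rev_induct) (auto simp: reduced_snoc simp flip: append_assoc)
  have "reduced E (rev v @ rev u)" using reduced_rev[OF assms] by simp
  then show ?thesis using reduced_rev[OF prefix] by fastforce
qed

text \<open>The first letter with non-positive charge cancels against the partner found by
  \<open>exchange\<close>. No new letters appear, so the result remains a word in the
  generators.\<close>

lemma shorten: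
  assumes "\<not> reduced E w"
  shows "\<exists>w'. racg_eq E w w' \<and> length w' < length w \<and> set w' \<subseteq> set w"
  using assms
proof (induction w rule: rev_induct)
  case (snoc s w)
  show ?case
  proof (cases "reduced E w")
    case True
    then have "charge E w s < 0"
      using snoc.prems regular_reduced[OF True]
      by (simp add: reduced_snoc regular_def order_less_le)
    then obtain u v where uv: "w = u @ s # v" "\<forall>t\<in>set v. {s, t} \<in> E"
      using exchange True by blast
    then show ?thesis
      using racg_eq_cancel[of v s E u] by (intro exI[of _ "u @ v"]) auto
  next
    case False
    then obtain w' where "racg_eq E w w'" "length w' < length w" "set w' \<subseteq> set w"
      using snoc.IH by blast
    then show ?thesis
      using racg_eq_append[of E w w' "[s]" "[s]"] by (intro exI[of _ "w' @ [s]"]) auto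
  qed
qed simp

lemma reduce: "\<exists>r. racg_eq E w r \<and> reduced E r \<and> length r \<le> length w \<and> set r \<subseteq> set w"
proof (induction w rule: length_induct)
  case (1 w)
  show ?case
  proof (cases "reduced E w")
    case True
    then show ?thesis by (intro exI[of _ w]) auto
  next
    case False
    then obtain w' where w': "racg_eq E w w'" "length w' < length w" "set w' \<subseteq> set w"
      using shorten by blast
    then obtain r where "racg_eq E w' r" "reduced E r" "length r \<le> length w'" "set r \<subseteq> set w'"
      using 1 by blast
    then show ?thesis using w' by (intro exI[of _ r]) (auto intro: racg_eq_trans)
  qed
qed

text \<open>Equivalent words have equal charges, so the last letter of \<open>w\<close> is also a
  descent of \<open>w'\<close>. There \<open>exchange\<close> finds it, and deleting it from both
  words reduces the claim to shorter ones.\<close>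

lemma reduced_length_unique:
  assumes "reduced E w" "reduced E w'" "racg_eq E w w'"
  shows "length w = length w'"
  using assms
proof (induction w arbitrary: w' rule: rev_induct)
  case Nil
  have "w' = []"
  proof (rule ccontr)
    assume "w' \<noteq> []"
    then obtain v s where "w' = v @ [s]" by (cases w' rule: rev_cases) auto
    then have "charge E w' s < 0"
      using Nil by (simp add: reduced_snoc charge_snoc fire_def)
    then show False using charge_cong[OF Nil(3)] by (simp flip: charge_cong[OF Nil(3)])
  qed
  then show ?case by simp
next
  case (snoc s w)
  have "charge E (w @ [s]) s < 0"
    using snoc.prems by (simp add: reduced_snoc charge_snoc fire_def)
  then have "charge E w' s < 0" using charge_cong[OF snoc.prems(3)] by simp
  then obtain u v where uv: "w' = u @ s # v" "\<forall>t\<in>set v. {s, t} \<in> E"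
    using exchange snoc.prems by blast
  have "racg_eq E w (w @ [s, s])"
    using racg_eq_append[OF racg_eq_refl racg_eq_square, of E w s] by (simp add: racg_eq_sym)
  also have "racg_eq E (w @ [s, s]) (w' @ [s])"
    using racg_eq_append[OF snoc.prems(3) racg_eq_refl, of "[s]"] by simp
  also have "racg_eq E (w' @ [s]) (u @ v)"
    using racg_eq_cancel[OF uv(2), of u] uv(1) by simp
  finally have "length w = length (u @ v)"
    using snoc uv reduced_delete by (intro snoc.IH) (auto simp: reduced_snoc)
  then show ?case using uv by simp
qed

section \<open>Word length and the word metric\<close>

lemma word_length_le: "racg_eq E u w \<Longrightarrow> w \<in> racg_words n \<Longrightarrow> word_length n E u \<le> length w"
  unfolding word_length_def by (rule Least_le) blast

lemma word_length_cong:
  assumes "racg_eq E u v"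
  shows "word_length n E u = word_length n E v"
proof -
  have "racg_eq E u w \<longleftrightarrow> racg_eq E v w" for w
    using assms racg_eq_trans racg_eq_sym by blast
  then show ?thesis by (simp add: word_length_def)
qed

lemma word_length_reduced:
  assumes "reduced E r" "racg_eq E u r" "r \<in> racg_words n"
  shows "word_length n E u = length r"
  unfolding word_length_def
proof (rule Least_equality)
  show "\<exists>w\<in>racg_words n. length w = length r \<and> racg_eq E u w" using assms by blast
  fix k assume "\<exists>w\<in>racg_words n. length w = k \<and> racg_eq E u w"
  then obtain w where w: "length w = k" "racg_eq E u w" by blast
  obtain r' where r': "racg_eq E w r'" "reduced E r'" "length r' \<le> length w"
    using reduce by blast
  have "racg_eq E r r'"
    using assms w r' racg_eq_trans racg_eq_sym by blast
  then show "length r \<le> k" using reduced_length_unique assms w r' by metis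
qed

lemma ex_reduced:
  assumes "u \<in> racg_words n"
  obtains r where "reduced E r" "racg_eq E u r" "r \<in> racg_words n" "length r = word_length n E u"
proof -
  obtain r where "racg_eq E u r" "reduced E r" "set r \<subseteq> set u" using reduce by blast
  moreover from this have "r \<in> racg_words n" using assms by (auto simp: racg_words_def)
  ultimately show ?thesis using word_length_reduced that by metis
qed

lemma reducedI:
  assumes "racg_eq E u w" "w \<in> racg_words n" "length w \<le> word_length n E u"
  shows "reduced E w"
proof (rule ccontr)
  assume "\<not> reduced E w"
  then obtain w' where w': "racg_eq E w w'" "length w' < length w" "set w' \<subseteq> set w"
    using shorten by blast
  then have "w' \<in> racg_words n" using assms by (auto simp: racg_words_def)
  then show False
    using word_length_le[of u w'] racg_eq_trans[OF assms(1) w'(1)] assms w' by simp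
qed

lemma regular_charge: "regular E (charge E u)"
  using reduce[of u] regular_reduced charge_cong by metis

text \<open>This turns the sign of a charge into geometry. In the negative case the new letter
  cancels inside a reduced representative, and \<open>reduced_delete\<close> keeps the remainder
  reduced.\<close>

lemma word_length_snoc:
  assumes "u \<in> racg_words n" "s < n"
  shows "if charge E u s > 0 then word_length n E (u @ [s]) = Suc (word_length n E u)
         else Suc (word_length n E (u @ [s])) = word_length n E u"
proof -
  obtain r where r: "reduced E r" "racg_eq E u r" "r \<in> racg_words n" "length r = word_length n E u"
    using ex_reduced assms by blast
  have eq: "racg_eq E (u @ [s]) (r @ [s])" using r racg_eq_append by simp
  show ?thesis
  proof (cases "charge E u s > 0")
    case True
    then have "reduced E (r @ [s])" using r charge_cong by (simp add: reduced_snoc)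
    then show ?thesis using word_length_reduced[OF _ eq] r assms True by simp
  next
    case False
    then have "charge E r s < 0"
      using regular_charge[of u] charge_cong[OF r(2)] by (simp add: regular_def order_less_le)
    then obtain x y where xy: "r = x @ s # y" "\<forall>t\<in>set y. {s, t} \<in> E"
      using exchange r by blast
    have "racg_eq E (r @ [s]) (x @ y)" using racg_eq_cancel[OF xy(2), of x] xy(1) by simp
    then have "word_length n E (u @ [s]) = length (x @ y)"
      using r xy eq by (intro word_length_reduced reduced_delete[of x s y]) (auto intro: racg_eq_trans)
    then show ?thesis using False r xy by simp
  qed
qed

lemma word_length_append:
  assumes "u \<in> racg_words n" "v \<in> racg_words n"
  shows "word_length n E (u @ v) \<le> word_length n E u + word_length n E v"
proof -
  obtain r r' where r: "racg_eq E u r" "r \<in> racg_words n" "length r = word_length n E u"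
    and r': "racg_eq E v r'" "r' \<in> racg_words n" "length r' = word_length n E v"
    using ex_reduced assms by metis
  have "word_length n E (u @ v) \<le> length (r @ r')"
    using r r' by (intro word_length_le racg_eq_append) auto
  then show ?thesis using r r' by simp
qed

lemma word_length_rev:
  assumes "u \<in> racg_words n"
  shows "word_length n E (rev u) = word_length n E u"
proof -
  have le: "word_length n E (rev u) \<le> word_length n E u" if u: "u \<in> racg_words n" for u
  proof -
    obtain r where "racg_eq E u r" "r \<in> racg_words n" "length r = word_length n E u"
      using ex_reduced[OF u] by metis
    then show ?thesis using word_length_le[of "rev u" "rev r"] racg_eq_rev by simp
  qed
  show ?thesis using le[of u] le[of "rev u"] assms by simp
qed

lemma dist_triangle_racg:
  assumes "x \<in> racg_words n" "y \<in> racg_words n" "z \<in> racg_words n"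
  shows "racg_dist n E x z \<le> racg_dist n E x y + racg_dist n E y z"
proof -
  have "racg_eq E ((rev x @ y) @ (rev y @ z)) (rev x @ z)"
    using racg_eq_context[OF racg_eq_rev_append, of E "rev x" y z] by simp
  then have "word_length n E (rev x @ z) = word_length n E ((rev x @ y) @ (rev y @ z))"
    using word_length_cong by metis
  also have "\<dots> \<le> word_length n E (rev x @ y) + word_length n E (rev y @ z)"
    using assms by (intro word_length_append) auto
  finally show ?thesis by (simp add: racg_dist_word_length)
qed

lemma dist_commute_racg:
  assumes "x \<in> racg_words n" "y \<in> racg_words n"
  shows "racg_dist n E x y = racg_dist n E y x"
  using word_length_rev[of "rev x @ y"] assms by (simp add: racg_dist_word_length)

lemma dist_self_racg: "x \<in> racg_words n \<Longrightarrow> racg_dist n E x x = 0"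
  using word_length_le[of "rev x @ x" "[]"] racg_eq_rev_append[of E "rev x"]
  by (simp add: racg_dist_word_length)

end

section \<open>A walk in the complement graph spans a contracting ray\<close>

locale complement_walk = coxeter_graph +
  fixes v :: "nat \<Rightarrow> nat" and M :: nat
  assumes v_less: "v i < n"
    and v_neq: "v (Suc i) \<noteq> v i"
    and v_nonadj: "{v i, v (Suc i)} \<notin> E"
    and v_visits: "s < n \<Longrightarrow> \<exists>j. i \<le> j \<and> j < i + M \<and> v j = s"
    and M_ge: "3 \<le> M"
begin

abbreviation ray :: "nat \<Rightarrow> nat list" where
  "ray i \<equiv> map v [0..<i]"

lemma v_words [simp]: "map v xs \<in> racg_words n"
  using v_less by (auto simp: racg_words_def)

text \<open>By \<open>word_length_snoc\<close>, the edge from \<open>ray i\<close> to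
  \<open>ray (Suc i)\<close> leads away from \<open>x\<close>.\<close>

definition leaving :: "nat list \<Rightarrow> nat \<Rightarrow> bool" where
  "leaving x i \<longleftrightarrow> charge E (rev x @ ray i) (v i) > 0"

definition ray_proj :: "nat list \<Rightarrow> nat" where
  "ray_proj x = (LEAST i. leaving x i)"

abbreviation (input) ray_dist :: "nat list \<Rightarrow> nat \<Rightarrow> nat" where
  "ray_dist x i \<equiv> word_length n E (rev x @ ray i)"

lemma ray_dist_Suc:
  assumes "x \<in> racg_words n"
  shows "if leaving x i then ray_dist x (Suc i) = Suc (ray_dist x i)
         else Suc (ray_dist x (Suc i)) = ray_dist x i"
  using word_length_snoc[of "rev x @ ray i" "v i", unfolded append_assoc] assms v_less
  by (simp add: leaving_def)

text \<open>Consecutive letters do not commute, so firing \<open>v i\<close> raises the charge of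
  \<open>v (Suc i)\<close> by twice a positive number, and regularity makes the result positive.
  Thus a geodesic ray, once it recedes from \<open>x\<close>, never approaches it again.\<close>

lemma leaving_Suc:
  assumes "leaving x i"
  shows "leaving x (Suc i)"
proof -
  let ?c = "charge E (rev x @ ray i)"
  have "?c (v i) + ?c (v (Suc i)) > 0"
    using regular_charge v_neq v_nonadj unfolding regular_def by metis
  moreover have "charge E (rev x @ ray (Suc i)) = fire E (v i) ?c"
    using charge_snoc[of E "rev x @ ray i" "v i"] by simp
  ultimately show ?thesis
    using assms v_neq[of i] v_nonadj[of i] by (simp add: leaving_def fire_def)
qed

lemma leaving_iff:
  assumes "x \<in> racg_words n"
  shows "leaving x i \<longleftrightarrow> ray_proj x \<le> i"
proof -
  have "\<exists>i. leaving x i"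
  proof (rule ccontr)
    assume none: "\<nexists>i. leaving x i"
    \<comment> \<open>If the ray approached \<open>x\<close> forever, its distance would drop by one
      at each step and become negative.\<close>
    have "ray_dist x i + i = ray_dist x 0" for i
    proof (induction i)
      case (Suc i)
      then show ?case using ray_dist_Suc[OF assms, of i] none by simp
    qed simp
    from this[of "Suc (ray_dist x 0)"] show False by simp
  qed
  then have start: "leaving x (ray_proj x)" unfolding ray_proj_def by (rule LeastI_ex)
  have "leaving x i" if "ray_proj x \<le> i"
    using that by (induction rule: dec_induct) (auto intro: start leaving_Suc)
  then show ?thesis by (auto simp: ray_proj_def intro: Least_le)
qed

lemma ray_dist_after:
  assumes "x \<in> racg_words n" "ray_proj x \<le> i"
  shows "ray_dist x i = ray_dist x (ray_proj x) + (i - ray_proj x)"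
  using assms(2)
proof (induction i rule: dec_induct)
  case (step i)
  then show ?case using ray_dist_Suc[OF assms(1), of i] by (simp add: leaving_iff assms(1))
qed simp

lemma ray_dist_before:
  assumes "x \<in> racg_words n" "i \<le> ray_proj x"
  shows "ray_dist x i = ray_dist x (ray_proj x) + (ray_proj x - i)"
  using assms(2)
proof (induction i rule: inc_induct)
  case (step i)
  then show ?case using ray_dist_Suc[OF assms(1), of i] by (simp add: leaving_iff assms(1))
qed simp

text \<open>A letter of \<open>u\<close> cancelling against one of \<open>w\<close> would have to commute with every letter of
  \<open>q\<close>, hence with itself.\<close>
lemma reduced_concat:
  assumes uq: "reduced E (u @ q)" and qw: "reduced E (q @ w)" and u: "set u \<subseteq> set q"
  shows "reduced E (u @ q @ w)"
  unfolding reduced_iff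
proof (intro allI impI)
  let ?z = "u @ q @ w"
  fix i j assume ij: "j < length ?z" "i < j" "?z ! i = ?z ! j"
  consider "j < length (u @ q)" | "length u \<le> i" | "i < length u" "length (u @ q) \<le> j"
    by linarith
  then show "\<exists>l. i < l \<and> l < j \<and> {?z ! j, ?z ! l} \<notin> E"
  proof cases
    case 1
    have nth: "?z ! m = (u @ q) ! m" if "m < length (u @ q)" for m
      using that by (metis append_assoc nth_append)
    obtain l where "i < l" "l < j" "{(u @ q) ! j, (u @ q) ! l} \<notin> E"
      using uq 1 ij nth[of i] nth[of j] unfolding reduced_iff by fastforce
    then show ?thesis using 1 nth[of j] nth[of l] by (intro exI[of _ l]) auto
  next
    case 2
    have nth: "?z ! (length u + m) = (q @ w) ! m" for m
      by (simp add: nth_append)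
    have "(q @ w) ! (i - length u) = (q @ w) ! (j - length u)"
      using ij 2 nth[of "i - length u"] nth[of "j - length u"] by simp
    moreover have "j - length u < length (q @ w)" "i - length u < j - length u"
      using ij 2 by auto
    ultimately obtain l where "i - length u < l" "l < j - length u"
      "{(q @ w) ! (j - length u), (q @ w) ! l} \<notin> E"
      using qw unfolding reduced_iff by blast
    then show ?thesis
      using ij 2 nth[of l] nth[of "j - length u"] by (intro exI[of _ "length u + l"]) auto
  next
    case 3
    then have "?z ! i \<in> set q" using u by (auto simp: nth_append)
    then obtain m where "m < length q" "q ! m = ?z ! i" by (auto simp: in_set_conv_nth)
    then show ?thesis
      using 3 ij by (intro exI[of _ "length u + m"]) (auto simp: nth_append)
  qed
qed

text \<open>With \<open>r\<close>, \<open>q\<close>, \<open>t\<close> the words from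
  \<open>x\<close> to the ray, along it, and from \<open>y\<close> to the ray,
  \<open>r @ q @ rev t\<close> represents the inverse of \<open>x\<close> times \<open>y\<close>. It
  is reduced by \<open>reduced_concat\<close>, as \<open>q\<close> has at least \<open>M\<close>
  letters and so contains every generator. Its length is therefore at least that of
  \<open>r\<close>.\<close>

lemma ray_contract:
  assumes x: "x \<in> racg_words n" and y: "y \<in> racg_words n" and far: "ray_proj x + M \<le> ray_proj y"
  shows "racg_dist n E x (ray (ray_proj x)) \<le> racg_dist n E x y"
proof -
  define i j q where "i = ray_proj x" and "j = ray_proj y" and "q = map v [i..<j]"
  have ray_j: "ray j = ray i @ q"
    using far upt_add_eq_append[of 0 i "j - i"] by (simp add: i_def j_def q_def)
  obtain r where r: "racg_eq E (rev x @ ray i) r" "r \<in> racg_words n" "length r = ray_dist x i"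
    using ex_reduced[of "rev x @ ray i"] x by auto
  obtain t where t: "racg_eq E (rev y @ ray j) t" "t \<in> racg_words n" "length t = ray_dist y j"
    using ex_reduced[of "rev y @ ray j"] y by auto
  have "reduced E (r @ q)"
  proof (rule reducedI)
    show "racg_eq E (rev x @ ray j) (r @ q)"
      using racg_eq_append[OF r(1) racg_eq_refl, of q] by (simp add: ray_j)
    show "length (r @ q) \<le> ray_dist x j"
      using ray_dist_after[OF x, of j] far r(3) by (simp add: i_def j_def q_def)
  qed (use r in \<open>simp add: q_def\<close>)
  moreover have "reduced E (q @ rev t)"
  proof -
    \<comment> \<open>This word returns from the projection of \<open>y\<close> to the start of the
      ray. \<open>ray_dist_before\<close> at index 0, where the ray is the empty word, shows that
      its length is minimal.\<close>
    have "reduced E (t @ rev (ray j))"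
    proof (rule reducedI)
      have "racg_eq E (rev y) (rev y @ ray j @ rev (ray j))"
        using racg_eq_append[OF racg_eq_refl racg_eq_rev_append, of E "rev y" "ray j"]
        by (simp add: racg_eq_sym)
      also have "racg_eq E \<dots> (t @ rev (ray j))"
        using racg_eq_append[OF t(1) racg_eq_refl, of "rev (ray j)"] by simp
      finally show "racg_eq E (rev y) (t @ rev (ray j))" .
      show "length (t @ rev (ray j)) \<le> word_length n E (rev y)"
        using ray_dist_before[OF y, of 0] t(3) by (simp add: j_def)
    qed (use t in \<open>simp flip: rev_map\<close>)
    then have "reduced E (ray i @ q @ rev t)"
      using reduced_rev by (fastforce simp: ray_j)
    then show ?thesis by (rule reduced_suffix)
  qed
  moreover have "set r \<subseteq> set q"
  proof
    fix s assume "s \<in> set r"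
    then have "s < n" using r by (auto simp: racg_words_def)
    then obtain l where "i \<le> l" "l < i + M" "v l = s" using v_visits by blast
    then show "s \<in> set q" using far by (auto simp: q_def i_def j_def)
  qed
  ultimately have red: "reduced E (r @ q @ rev t)" by (rule reduced_concat)
  have "racg_eq E (rev x @ y) (rev x @ (ray j @ rev (ray j)) @ y)"
    using racg_eq_context[OF racg_eq_rev_append, of E "rev x" "ray j" y] by (simp add: racg_eq_sym)
  also have "racg_eq E \<dots> ((r @ q) @ rev t)"
    using racg_eq_append[OF racg_eq_append[OF r(1) racg_eq_refl[of E q]] racg_eq_rev[OF t(1)]]
    by (simp add: ray_j)
  finally have "word_length n E (rev x @ y) = length (r @ q @ rev t)"
    using word_length_reduced[OF red] r t by (simp add: q_def)
  then show ?thesis using r by (simp add: racg_dist_word_length i_def)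
qed

lemma ray_contracting: "contracting_ray (racg_words n) (racg_dist n E) ray ray_proj M"
proof (rule contracting_ray.intro)
  fix x i assume x: "x \<in> racg_words n"
  have "real (ray_dist x i) = real (ray_dist x (ray_proj x)) + \<bar>real i - real (ray_proj x)\<bar>"
  proof (cases "i \<le> ray_proj x")
    case True
    then show ?thesis unfolding ray_dist_before[OF x True] by linarith
  next
    case False
    then have "ray_proj x \<le> i" by simp
    then show ?thesis unfolding ray_dist_after[OF x \<open>ray_proj x \<le> i\<close>] by linarith
  qed
  then show "racg_dist n E x (ray i)
      = racg_dist n E x (ray (ray_proj x)) + \<bar>real i - real (ray_proj x)\<bar>"
    unfolding racg_dist_word_length .
qed (use v_words M_ge dist_self_racg dist_commute_racg dist_triangle_racg ray_contract
      in \<open>simp_all only: racg_dist_word_length of_nat_0_le_iff\<close>)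

end

section \<open>Asymptotically almost surely the complement has diameter two\<close>

definition common_nonneighbour :: "nat \<Rightarrow> nat set set \<Rightarrow> bool" where
  "common_nonneighbour n E \<longleftrightarrow> (\<forall>s<n. \<forall>t<n. s \<noteq> t \<longrightarrow>
     (\<exists>w<n. w \<noteq> s \<and> w \<noteq> t \<and> {s, w} \<notin> E \<and> {t, w} \<notin> E))"

lemma not_wide_and_quadratic_div:
  assumes E: "E \<subseteq> all_edges n" and n: "3 \<le> n" and diam: "common_nonneighbour n E"
  shows "\<not> wide (racg_words n) (racg_dist n E) \<and>
    at_least_quadratic_div (racg_words n) (racg_dist n E)"
proof -
  define f where "f = (\<lambda>s t. SOME w. w < n \<and> w \<noteq> s \<and> w \<noteq> t \<and> {s, w} \<notin> E \<and> {t, w} \<notin> E)"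
  have f: "f s t < n \<and> f s t \<noteq> s \<and> f s t \<noteq> t \<and> {s, f s t} \<notin> E \<and> {t, f s t} \<notin> E"
    if "s < n" "t < n" "s \<noteq> t" for s t
    unfolding f_def by (rule someI_ex) (use diam that in \<open>simp add: common_nonneighbour_def\<close>)
  \<comment> \<open>Even positions run cyclically through all vertices; each odd position holds a
    common non-neighbour of the two vertices around it.\<close>
  define v where
    "v = (\<lambda>i. if even i then (i div 2) mod n else f ((i div 2) mod n) (Suc (i div 2) mod n))"
  have succ: "q mod n \<noteq> Suc q mod n" for q
    using n by (simp add: mod_Suc)
  have mod: "q mod n < n" for q using n by simp
  note fq = f[OF mod mod succ]
  have "complement_walk n E v (2 * n)"
  proof
    show "{s} \<notin> E" for s
    proof
      assume "{s} \<in> E"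
      then obtain i j where "{s} = {i, j}" "i < j" using E by (auto simp: all_edges_def)
      then show False by (metis doubleton_eq_iff insert_absorb2 less_irrefl)
    qed
    show "v i < n" for i using n fq by (simp add: v_def)
    show "v (Suc i) \<noteq> v i" for i
      using fq[of "i div 2"] by (cases "even i") (auto simp: v_def elim!: oddE)
    show "{v i, v (Suc i)} \<notin> E" for i
      using fq[of "i div 2"] by (cases "even i") (auto simp: v_def insert_commute elim!: oddE)
    show "\<exists>j. i \<le> j \<and> j < i + 2 * n \<and> v j = s" if s: "s < n" for i s
    proof -
      \<comment> \<open>Half of \<open>i\<close> rounded up, so \<open>2 * q\<close> is the first
        even position from \<open>i\<close> on. Then \<open>r\<close> is the first index from
        \<open>q\<close> on that is congruent to \<open>s\<close> modulo \<open>n\<close>.\<close>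
      define q where "q = Suc i div 2"
      define r where "r = (if q mod n \<le> s then q + (s - q mod n) else q + (s + n - q mod n))"
      have "r = n * (if q mod n \<le> s then q div n else Suc (q div n)) + s"
      proof (cases "q mod n \<le> s")
        case True
        then have "r = q + (s - q mod n)" by (simp add: r_def)
        then have "r = n * (q div n) + s" using True mult_div_mod_eq[of n q] by linarith
        then show ?thesis using True by simp
      next
        case False
        then have "r = q + (s + n - q mod n)" by (simp add: r_def)
        then have "r = n + n * (q div n) + s"
          using mod[of q] mult_div_mod_eq[of n q] by linarith
        then show ?thesis using False by simp
      qed
      then have "r mod n = s" using s by simp
      moreover have "q \<le> r" "r < q + n" using s mod[of q] by (auto simp: r_def)
      then have "i \<le> 2 * r" "2 * r < i + 2 * n" by (auto simp: q_def)
      ultimately show ?thesis by (intro exI[of _ "2 * r"]) (simp add: v_def)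
    qed
    show "3 \<le> 2 * n" using n by simp
  qed
  then interpret complement_walk n E v "2 * n" .
  interpret contracting_ray "racg_words n" "racg_dist n E" ray ray_proj "2 * n"
    by (rule ray_contracting)
  show ?thesis using not_wide at_least_quadratic by blast
qed

section \<open>Edge sets in the random graph and the union bound\<close>

lemma finite_all_edges [simp]: "finite (all_edges n)"
proof (rule finite_subset)
  show "all_edges n \<subseteq> Pow {..<n}" by (auto simp: all_edges_def)
qed simp

lemma sum_Pow_binomial:
  assumes "finite A"
  shows "(\<Sum>X\<in>Pow A. p ^ card X * q ^ (card A - card X)) = ((p + q) ^ card A :: real)"
proof -
  have "(\<Prod>x\<in>A. p + q) = (\<Sum>X\<in>Pow A. (\<Prod>x\<in>X. p) * (\<Prod>x\<in>A - X. q))"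
    using assms by (rule prod_add)
  also have "\<dots> = (\<Sum>X\<in>Pow A. p ^ card X * q ^ (card A - card X))"
    using assms by (intro sum.cong) (auto simp: card_Diff_subset finite_subset)
  finally show ?thesis by simp
qed

text \<open>Writing \<open>E\<close> as \<open>S\<close> together with a set \<open>T\<close> of
  other edges factors the weight; the sum over \<open>T\<close> is the binomial expansion of
  \<open>(p + (1 - p))\<close> to a power, hence 1.\<close>

lemma gnp_prob_superset:
  assumes S: "S \<subseteq> all_edges n"
  shows "gnp_prob n p (\<lambda>E. S \<subseteq> E) = p ^ card S"
proof -
  let ?A = "all_edges n"
  have fin: "finite S" "finite (?A - S)" using finite_subset[OF S] by auto
  have "gnp_prob n p (\<lambda>E. S \<subseteq> E)
      = (\<Sum>E\<in>{E \<in> Pow ?A. S \<subseteq> E}. p ^ card E * (1 - p) ^ (card ?A - card E))"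
    unfolding gnp_prob_def by (rule sum.inter_filter[symmetric]) simp
  also have "\<dots> = (\<Sum>T\<in>Pow (?A - S). p ^ card (S \<union> T) * (1 - p) ^ (card ?A - card (S \<union> T)))"
    using S by (intro sum.reindex_bij_witness[of _ "\<lambda>T. S \<union> T" "\<lambda>E. E - S"]) (auto simp: Un_absorb1)
  also have "\<dots> = (\<Sum>T\<in>Pow (?A - S).
      p ^ card S * (p ^ card T * (1 - p) ^ (card (?A - S) - card T)))"
  proof (rule sum.cong)
    fix T assume "T \<in> Pow (?A - S)"
    then have "card (S \<union> T) = card S + card T"
      using fin finite_subset by (intro card_Un_disjoint) blast+
    then show "p ^ card (S \<union> T) * (1 - p) ^ (card ?A - card (S \<union> T))
        = p ^ card S * (p ^ card T * (1 - p) ^ (card (?A - S) - card T))"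
      using S fin by (simp add: power_add card_Diff_subset)
  qed simp
  also have "\<dots> = p ^ card S"
    using sum_Pow_binomial[OF fin(2), of p "1 - p"] by (simp flip: sum_distrib_left)
  finally show ?thesis .
qed

lemma gnp_prob_mono:
  assumes p: "0 \<le> p" "p \<le> 1" and "\<And>E. E \<subseteq> all_edges n \<Longrightarrow> P E \<Longrightarrow> Q E"
  shows "gnp_prob n p P \<le> gnp_prob n p Q"
  unfolding gnp_prob_def by (intro sum_mono) (use assms in auto)

lemma gnp_prob_True: "gnp_prob n p (\<lambda>E. True) = 1"
  using gnp_prob_superset[of "{}" n p] by simp

lemma gnp_prob_union_bound:
  assumes p: "0 \<le> p" "p \<le> 1" and fin: "finite I"
    and S: "\<And>i. i \<in> I \<Longrightarrow> S i \<subseteq> all_edges n"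
    and cover: "\<And>E. E \<subseteq> all_edges n \<Longrightarrow> \<not> Q E \<Longrightarrow> \<exists>i\<in>I. S i \<subseteq> E"
  shows "1 - (\<Sum>i\<in>I. p ^ card (S i)) \<le> gnp_prob n p Q"
proof -
  define W where "W = (\<lambda>E :: nat set set. p ^ card E * (1 - p) ^ (card (all_edges n) - card E))"
  have W: "0 \<le> W E" for E using p by (simp add: W_def)
  have "1 = (\<Sum>E\<in>Pow (all_edges n). W E)"
    using gnp_prob_True[of n p] by (simp add: gnp_prob_def W_def)
  also have "\<dots> \<le> (\<Sum>E\<in>Pow (all_edges n).
      (if Q E then W E else 0) + (\<Sum>i\<in>I. if S i \<subseteq> E then W E else 0))"
  proof (rule sum_mono)
    fix E assume E: "E \<in> Pow (all_edges n)"
    have nonneg: "0 \<le> (\<Sum>i\<in>I. if S i \<subseteq> E then W E else 0)"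
      using W by (intro sum_nonneg) auto
    show "W E \<le> (if Q E then W E else 0) + (\<Sum>i\<in>I. if S i \<subseteq> E then W E else 0)"
    proof (cases "Q E")
      case False
      then obtain i where "i \<in> I" "S i \<subseteq> E" using cover E by blast
      then show ?thesis
        using False W fin member_le_sum[of i I "\<lambda>i. if S i \<subseteq> E then W E else 0"] by auto
    qed (use nonneg in simp)
  qed
  also have "\<dots> = gnp_prob n p Q + (\<Sum>i\<in>I. gnp_prob n p (\<lambda>E. S i \<subseteq> E))"
    unfolding sum.distrib sum.swap[of _ I] gnp_prob_def W_def ..
  also have "(\<Sum>i\<in>I. gnp_prob n p (\<lambda>E. S i \<subseteq> E)) = (\<Sum>i\<in>I. p ^ card (S i))"
    using S by (intro sum.cong) (auto simp: gnp_prob_superset)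
  finally show ?thesis by simp
qed

text \<open>If \<open>s\<close> and \<open>t\<close> have no common non-neighbour, every other
  vertex is joined to \<open>s\<close> or to \<open>t\<close>. The set \<open>T\<close> records a
  choice of one such edge for each vertex, so \<open>E\<close> contains one of at most
  \<open>n ^ 2 * 2 ^ n\<close> sets of \<open>n - 2\<close> edges.\<close>

lemma gnp_prob_common_nonneighbour:
  assumes p: "0 \<le> p" "p \<le> 1"
  shows "1 - 4 * real n ^ 2 * (2 * p) ^ (n - 2) \<le> gnp_prob n p (common_nonneighbour n)"
proof -
  define I where "I = {(s, t). s < n \<and> t < n \<and> s \<noteq> t} \<times> Pow {..<n}"
  define rest where "rest = (\<lambda>s t :: nat. {..<n} - {s, t})"
  define edge where "edge = (\<lambda>s t T (w :: nat). {if w \<in> T then s else t, w :: nat})"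
  define S where "S = (\<lambda>((s, t), T). edge s t T ` rest s t)"
  have pairs: "{(s, t). s < n \<and> t < n \<and> s \<noteq> t} \<subseteq> {..<n} \<times> {..<n}" by auto
  have fin: "finite I" unfolding I_def using finite_subset[OF pairs] by simp
  have card_S: "card (S i) = n - 2" if mem: "i \<in> I" for i
  proof -
    obtain s t T where i: "i = ((s, t), T)" "s < n" "t < n" "s \<noteq> t"
      using mem by (auto simp: I_def)
    \<comment> \<open>The vertex \<open>w\<close> is the end of its edge outside
      \<open>{s, t}\<close>, so distinct vertices give distinct edges.\<close>
    have "inj_on (edge s t T) (rest s t)"
      by (auto simp: inj_on_def edge_def rest_def doubleton_eq_iff split: if_splits)
    then have "card (S i) = card (rest s t)" by (simp add: S_def i card_image)
    also have "\<dots> = n - 2" using i by (simp add: rest_def card_Diff_subset)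
    finally show ?thesis .
  qed
  have S_sub: "S i \<subseteq> all_edges n" if "i \<in> I" for i
  proof -
    have edges: "{a, b} \<in> all_edges n" if "a < n" "b < n" "a \<noteq> b" for a b
    proof (cases "a < b")
      case True
      then show ?thesis using that by (auto simp: all_edges_def)
    next
      case False
      then have "{b, a} \<in> all_edges n"
        using that unfolding all_edges_def by (intro CollectI exI[of _ b] exI[of _ a]) simp
      then show ?thesis by (simp add: insert_commute)
    qed
    show ?thesis
      using that by (auto simp: I_def S_def edge_def rest_def intro!: edges split: if_splits)
  qed
  have "1 - (\<Sum>i\<in>I. p ^ card (S i)) \<le> gnp_prob n p (common_nonneighbour n)"
  proof (rule gnp_prob_union_bound[OF p fin S_sub])
    fix E assume "\<not> common_nonneighbour n E"
    then obtain s t where st: "s < n" "t < n" "s \<noteq> t"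
      and none: "\<And>w. w < n \<Longrightarrow> w \<noteq> s \<Longrightarrow> w \<noteq> t \<Longrightarrow> {s, w} \<in> E \<or> {t, w} \<in> E"
      unfolding common_nonneighbour_def by blast
    define T where "T = {w. w < n \<and> {s, w} \<in> E}"
    have "S ((s, t), T) \<subseteq> E"
      by (auto simp: S_def edge_def rest_def T_def split: if_splits dest: none)
    moreover have "((s, t), T) \<in> I" using st by (auto simp: I_def T_def)
    ultimately show "\<exists>i\<in>I. S i \<subseteq> E" by blast
  qed
  moreover have "(\<Sum>i\<in>I. p ^ card (S i)) \<le> 4 * real n ^ 2 * (2 * p) ^ (n - 2)"
  proof (cases "2 \<le> n")
    case True
    have "card I \<le> n ^ 2 * 2 ^ n"
      using card_mono[OF _ pairs] by (simp add: I_def card_cartesian_product card_Pow power2_eq_square)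
    then have "real (card I) \<le> real (n ^ 2 * 2 ^ n)" by (simp only: of_nat_le_iff)
    then have "real (card I) * p ^ (n - 2) \<le> real n ^ 2 * 2 ^ n * p ^ (n - 2)"
      using p by (intro mult_right_mono) auto
    moreover obtain m where "n = 2 + m" using True le_Suc_ex by blast
    then have "(2 :: real) ^ n = 4 * 2 ^ (n - 2)" by simp
    ultimately show ?thesis using card_S by (simp add: power_mult_distrib)
  next
    case False
    then have "I = {}" by (auto simp: I_def)
    then show ?thesis using p by simp
  qed
  ultimately show ?thesis by linarith
qed

theorem theorem3p3:
  fixes p :: "nat \<Rightarrow> real"
  assumes "\<forall>n. 0 \<le> p n \<and> p n \<le> 1"
    and "p \<in> o(\<lambda>n. real n powr (- (real n / (2 * (real n - 2)))))"
  shows "(\<lambda>n. gnp_prob n (p n)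
            (\<lambda>E. \<not> wide (racg_words n) (racg_dist n E) \<and>
                 at_least_quadratic_div (racg_words n) (racg_dist n E)))
         \<longlonglongrightarrow> 1"
proof (rule tendsto_sandwich)
  have p: "0 \<le> p n" "p n \<le> 1" for n using assms(1) by auto
  \<comment> \<open>The exponent tends to \<open>-1/2\<close>, so the bound on \<open>p\<close>
    tends to 0.\<close>
  have "(\<lambda>n. real n powr (- (real n / (2 * (real n - 2))))) \<in> o(\<lambda>_. 1)"
    by real_asymp
  with assms(2) have "p \<in> o(\<lambda>_. 1)" by (rule landau_o.small_trans)
  then have "p \<longlonglongrightarrow> 0" using smalloD_tendsto by fastforce
  \<comment> \<open>With \<open>p n\<close> below \<open>1 / 4\<close> the base
    \<open>2 * p n\<close> is at most \<open>1 / 2\<close>, and the geometric factor beats the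
    quadratic one.\<close>
  then have small: "eventually (\<lambda>n. p n < 1 / 4) sequentially"
    by (rule order_tendstoD) simp
  show "eventually (\<lambda>n. 1 - 4 * real n ^ 2 * (1 / 2) ^ (n - 2) \<le> gnp_prob n (p n)
      (\<lambda>E. \<not> wide (racg_words n) (racg_dist n E) \<and>
           at_least_quadratic_div (racg_words n) (racg_dist n E))) sequentially"
    using small eventually_ge_at_top[of 3]
  proof eventually_elim
    case (elim n)
    have "(2 * p n) ^ (n - 2) \<le> (1 / 2) ^ (n - 2)"
      using elim p[of n] by (intro power_mono) auto
    then have "1 - 4 * real n ^ 2 * (1 / 2) ^ (n - 2) \<le> 1 - 4 * real n ^ 2 * (2 * p n) ^ (n - 2)"
      by (intro diff_left_mono mult_left_mono) auto
    also have "\<dots> \<le> gnp_prob n (p n) (common_nonneighbour n)"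
      using p by (rule gnp_prob_common_nonneighbour)
    also have "\<dots> \<le> gnp_prob n (p n) (\<lambda>E. \<not> wide (racg_words n) (racg_dist n E) \<and>
        at_least_quadratic_div (racg_words n) (racg_dist n E))"
      using p elim by (intro gnp_prob_mono not_wide_and_quadratic_div) auto
    finally show ?case .
  qed
  show "eventually (\<lambda>n. gnp_prob n (p n) (\<lambda>E. \<not> wide (racg_words n) (racg_dist n E) \<and>
      at_least_quadratic_div (racg_words n) (racg_dist n E)) \<le> 1) sequentially"
    using gnp_prob_mono[OF p] gnp_prob_True by (metis (no_types, lifting) always_eventually)
  \<comment> \<open>From \<open>n = 2\<close> on the truncated difference in the exponent is
    genuine, and pulling out \<open>(1 / 2) ^ 2\<close> turns 4 into 16.\<close>
  have "(\<lambda>n. 1 - 4 * real n ^ 2 * (1 / 2) ^ (n - 2)) \<longlonglongrightarrow> 1 \<longleftrightarrow>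
      (\<lambda>n. 1 - 16 * real n ^ 2 * (1 / 2) ^ n :: real) \<longlonglongrightarrow> 1"
  proof (rule tendsto_cong)
    show "eventually (\<lambda>n. 1 - 4 * real n ^ 2 * (1 / 2) ^ (n - 2)
        = (1 - 16 * real n ^ 2 * (1 / 2) ^ n :: real)) sequentially"
      using eventually_ge_at_top[of 2]
    proof eventually_elim
      case (elim n)
      then obtain m where "n = 2 + m" using le_Suc_ex by blast
      then show ?case by (simp add: power2_eq_square)
    qed
  qed
  moreover have "(\<lambda>n. 1 - 16 * real n ^ 2 * (1 / 2) ^ n :: real) \<longlonglongrightarrow> 1"
    by real_asymp
  ultimately show "(\<lambda>n. 1 - 4 * real n ^ 2 * (1 / 2) ^ (n - 2) :: real) \<longlonglongrightarrow> 1"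
    by blast
qed simp

end
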